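(* Let $G$ be a finite simple graph of order $2n$ that has a perfect matching, and suppose $f(G)=k$ where $0\leq k\leq n-1$. Then $$e(G)\leq n^2+2nk-k^2-k,$$ and equality holds if and only if $G$ is isomorphic to $\hat{H}_{n-k,0}\vee K_{2k}$.
   Context: For a graph $G$ with a perfect matching $M$, a subset $S\subseteq M$ is a forcing set of $M$ if $S$ is contained in no perfect matching of $G$ other than $M$. The forcing number $f(G,M)$ is the minimum size of a forcing set of $M$, and the minimum forcing number is $f(G)=\min_M f(G,M)$ over all perfect matchings $M$ of $G$. $e(G)$ denotes the number of edges. For $m\geq 1$, $H_{m,0}$ is the bipartite graph with parts $U=\{u_1,\dots,u_m\}$, $V=\{v_1,\dots,v_m\}$ in which $u_iv_j$ is an edge if and only if $i\geq j$; $\hat{H}_{m,0}$ is obtained from $H_{m,0}$ by adding all edges between pairs of vertices of $V$. $K_{2k}$ is the complete graph on $2k$ vertices ($K_0$ is the empty graph). The join $G\vee H$ is the disjoint union of $G$ and $H$ together with all edges $xy$, $x\in V(G)$, $y\in V(H)$. *)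

theory Defs
  imports Main
begin

record 'a ugraph =
  verts :: "'a set"
  edges :: "'a set set"

definition simple_graph :: "'a ugraph \<Rightarrow> bool" where
  "simple_graph G \<longleftrightarrow>
     finite (verts G) \<and> (\<forall>e\<in>edges G. e \<subseteq> verts G \<and> card e = 2)"

definition graph_iso :: "'a ugraph \<Rightarrow> 'b ugraph \<Rightarrow> bool" where
  "graph_iso G H \<longleftrightarrow>
     (\<exists>f. bij_betw f (verts G) (verts H) \<and>
          (\<forall>x\<in>verts G. \<forall>y\<in>verts G. {x, y} \<in> edges G \<longleftrightarrow> {f x, f y} \<in> edges H))"

definition perfect_matching :: "'a ugraph \<Rightarrow> 'a set set \<Rightarrow> bool" where
  "perfect_matching G M \<longleftrightarrow>
     M \<subseteq> edges G \<and> (\<forall>v\<in>verts G. \<exists>!e. e \<in> M \<and> v \<in> e)"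

definition forcing_set :: "'a ugraph \<Rightarrow> 'a set set \<Rightarrow> 'a set set \<Rightarrow> bool" where
  "forcing_set G M S \<longleftrightarrow>
     S \<subseteq> M \<and> (\<forall>M'. perfect_matching G M' \<and> S \<subseteq> M' \<longrightarrow> M' = M)"

text \<open>The two minima below are over nonempty sets of naturals whenever \<open>G\<close> is a finite simple
  graph, \<open>M\<close> is a perfect matching of \<open>G\<close> (then \<open>M\<close> is a forcing set of itself) and, for the
  second one, \<open>G\<close> has a perfect matching.  Otherwise their values carry no meaning.\<close>

definition forcing_number :: "'a ugraph \<Rightarrow> 'a set set \<Rightarrow> nat" where
  "forcing_number G M = (LEAST s. \<exists>S. forcing_set G M S \<and> card S = s)"

definition min_forcing_number :: "'a ugraph \<Rightarrow> nat" where
  "min_forcing_number G = (LEAST s. \<exists>M. perfect_matching G M \<and> forcing_number G M = s)"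

text \<open>\<open>half_graph m\<close> is $H_{m,0}$ and \<open>half_graph_hat m\<close> is $\hat{H}_{m,0}$, where
  \<open>Inl i\<close> stands for $u_i$ and \<open>Inr j\<close> for $v_j$.\<close>

definition half_graph :: "nat \<Rightarrow> (nat + nat) ugraph" where
  "half_graph m =
     \<lparr> verts = {1..m} <+> {1..m},
       edges = {{Inl i, Inr j} | i j. i \<in> {1..m} \<and> j \<in> {1..m} \<and> i \<ge> j} \<rparr>"

definition half_graph_hat :: "nat \<Rightarrow> (nat + nat) ugraph" where
  "half_graph_hat m =
     \<lparr> verts = verts (half_graph m),
       edges = edges (half_graph m) \<union>
         {{Inr i, Inr j} | i j. i \<in> {1..m} \<and> j \<in> {1..m} \<and> i \<noteq> j} \<rparr>"

definition complete_graph :: "nat \<Rightarrow> nat ugraph" where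
  "complete_graph N = \<lparr> verts = {1..N}, edges = {e. e \<subseteq> {1..N} \<and> card e = 2} \<rparr>"

definition graph_join :: "'a ugraph \<Rightarrow> 'b ugraph \<Rightarrow> ('a + 'b) ugraph" where
  "graph_join G H =
     \<lparr> verts = verts G <+> verts H,
       edges = (\<lambda>e. Inl ` e) ` edges G \<union> (\<lambda>e. Inr ` e) ` edges H \<union>
         {{Inl x, Inr y} | x y. x \<in> verts G \<and> y \<in> verts H} \<rparr>"

lemma simple_graph_half_graph: "simple_graph (half_graph m)"
  by (auto simp: simple_graph_def half_graph_def card_insert_if)

lemma simple_graph_half_graph_hat: "simple_graph (half_graph_hat m)"
  by (auto simp: simple_graph_def half_graph_hat_def half_graph_def card_insert_if)

lemma simple_graph_complete_graph: "simple_graph (complete_graph N)"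
  by (auto simp: simple_graph_def complete_graph_def)

lemma simple_graph_join:
  assumes "simple_graph G" "simple_graph H"
  shows "simple_graph (graph_join G H)"
  using assms
  by (auto simp: simple_graph_def graph_join_def card_insert_if card_image; blast)

end

theory Submission
  imports Defs
begin

text \<open>Take a perfect matching \<open>M\<close> with a forcing set \<open>S\<close> of size \<open>k\<close>, and let \<open>W\<close> be the set of vertices
  not covered by \<open>S\<close>, with \<open>p\<close> mapping each vertex to its partner in \<open>M\<close>. Since \<open>S\<close> is forcing, \<open>W\<close>
  contains no alternating cycle. For ordered pairs of vertices of \<open>W\<close> in different matching edges,
  the absence of alternating 4-cycles says that \<open>(x, y)\<close> or \<open>(p x, p y)\<close> is nonadjacent, so at least
  half of these pairs are nonadjacent, which is the bound. In the case of equality exactly one of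
  the two is nonadjacent and all other pairs of vertices are adjacent; then for any two matching
  edges in \<open>W\<close> exactly one of the four vertices is adjacent to both ends of the other edge. The
  absence of alternating 6-cycles makes this domination relation a transitive tournament on the
  matching edges, and the rank in this order gives the indices of the half graph.\<close>

section \<open>Counting nonadjacent pairs\<close>

abbreviation adjacent :: "'a ugraph \<Rightarrow> 'a \<Rightarrow> 'a \<Rightarrow> bool" where
  "adjacent G x y \<equiv> {x, y} \<in> edges G"

text \<open>Ordered pairs, so that \<open>map_prod p p\<close> acts on them; each missing edge is
  counted twice.\<close>

definition nonadjacent_pairs :: "'a ugraph \<Rightarrow> ('a \<times> 'a) set" where
  "nonadjacent_pairs G = {(x, y) \<in> verts G \<times> verts G. x \<noteq> y \<and> \<not> adjacent G x y}"

definition cross_pairs :: "'a set \<Rightarrow> ('a \<Rightarrow> 'a) \<Rightarrow> ('a \<times> 'a) set" where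
  "cross_pairs W p = Sigma W (\<lambda>x. W - {x, p x})"

lemma finite_edges: "simple_graph G \<Longrightarrow> finite (edges G)"
  unfolding simple_graph_def by (meson Pow_iff finite_Pow_iff finite_subset subsetI)

lemma adjacent_irrefl: "simple_graph G \<Longrightarrow> \<not> adjacent G x x"
  unfolding simple_graph_def by fastforce

lemma adjacent_verts: "simple_graph G \<Longrightarrow> adjacent G x y \<Longrightarrow> x \<in> verts G \<and> y \<in> verts G"
  unfolding simple_graph_def by blast

lemma finite_nonadjacent_pairs: "simple_graph G \<Longrightarrow> finite (nonadjacent_pairs G)"
  unfolding nonadjacent_pairs_def simple_graph_def
  by (rule finite_subset[where B = "verts G \<times> verts G"]) auto

lemma card_arcs:
  assumes "simple_graph G"
  shows "card {(x, y). adjacent G x y} = 2 * card (edges G)"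
proof -
  have fiber: "card {(x, y). {x, y} = e} = 2" if e: "e \<in> edges G" for e
  proof -
    have "card e = 2"
      using assms e by (auto simp: simple_graph_def)
    then obtain a b where "e = {a, b}" "a \<noteq> b"
      by (auto simp: card_2_iff)
    then have "{(x, y). {x, y} = e} = {(a, b), (b, a)}"
      by (auto simp: doubleton_eq_iff)
    then show ?thesis
      using \<open>a \<noteq> b\<close> by simp
  qed
  have "{(x, y). adjacent G x y} = (\<Union>e\<in>edges G. {(x, y). {x, y} = e})"
    by auto
  moreover have "card (\<Union>e\<in>edges G. {(x, y). {x, y} = e}) = (\<Sum>e\<in>edges G. card {(x, y). {x, y} = e})"
  proof (rule card_UN_disjoint)
    show "finite (edges G)"
      using assms by (rule finite_edges)
    show "\<forall>e\<in>edges G. finite {(x, y). {x, y} = e}"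
      using fiber by (metis card.infinite zero_neq_numeral)
  qed auto
  ultimately show ?thesis
    using fiber by simp
qed

lemma card_edges_nonadjacent_pairs:
  assumes "simple_graph G"
  shows "2 * card (edges G) + card (nonadjacent_pairs G) = card (verts G) * (card (verts G) - 1)"
proof -
  let ?A = "{(x, y). adjacent G x y}" and ?V = "verts G"
  have V: "finite ?V"
    using assms by (simp add: simple_graph_def)
  have eq: "?A \<union> nonadjacent_pairs G = Sigma ?V (\<lambda>x. ?V - {x})"
    using adjacent_verts[OF assms] adjacent_irrefl[OF assms]
    by (fastforce simp: nonadjacent_pairs_def)
  have "finite (?A \<union> nonadjacent_pairs G)"
    unfolding eq using V by simp
  then have "card (?A \<union> nonadjacent_pairs G) = card ?A + card (nonadjacent_pairs G)"
    by (intro card_Un_disjoint) (auto simp: nonadjacent_pairs_def)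
  moreover have "card (Sigma ?V (\<lambda>x. ?V - {x})) = card ?V * (card ?V - 1)"
    using V by simp
  ultimately show ?thesis
    using card_arcs[OF assms] eq by simp
qed

text \<open>Since \<open>graph_iso\<close> speaks of adjacency of pairs of vertices, the bijection
  is applied to ordered adjacent pairs, which number twice the edges.\<close>

lemma card_edges_graph_iso:
  assumes "simple_graph G" "simple_graph H" "graph_iso G H"
  shows "card (edges G) = card (edges H)"
proof -
  obtain f where f: "bij_betw f (verts G) (verts H)"
    and adj: "\<And>x y. x \<in> verts G \<Longrightarrow> y \<in> verts G \<Longrightarrow> adjacent G x y \<longleftrightarrow> adjacent H (f x) (f y)"
    using assms(3) by (auto simp: graph_iso_def)
  let ?A = "{(x, y). adjacent G x y}" and ?B = "{(x, y). adjacent H x y}"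
  have "?A \<subseteq> verts G \<times> verts G"
    using adjacent_verts[OF assms(1)] by blast
  moreover have "inj_on (map_prod f f) (verts G \<times> verts G)"
    using f by (intro map_prod_inj_on) (auto simp: bij_betw_def)
  ultimately have "inj_on (map_prod f f) ?A"
    by (rule inj_on_subset[rotated])
  then have "card (map_prod f f ` ?A) = card ?A"
    by (rule card_image)
  moreover have "map_prod f f ` ?A = ?B"
  proof (intro equalityI subsetI)
    fix q assume "q \<in> map_prod f f ` ?A"
    then obtain x y where "adjacent G x y" "q = (f x, f y)"
      by auto
    then show "q \<in> ?B"
      using adj adjacent_verts[OF assms(1)] by blast
  next
    fix q assume "q \<in> ?B"
    then obtain a b where q: "q = (a, b)" "adjacent H a b"
      by blast
    then have "a \<in> f ` verts G" "b \<in> f ` verts G"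
      using f adjacent_verts[OF assms(2) q(2)] by (auto simp: bij_betw_def)
    then obtain x y where xy: "x \<in> verts G" "y \<in> verts G" "a = f x" "b = f y"
      by blast
    then have "(x, y) \<in> ?A"
      using q adj by blast
    then show "q \<in> map_prod f f ` ?A"
      using q xy by (intro image_eqI[of _ _ "(x, y)"]) simp_all
  qed
  ultimately have "card ?B = card ?A"
    by simp
  then show ?thesis
    unfolding card_arcs[OF assms(1)] card_arcs[OF assms(2)] by simp
qed

text \<open>The map \<open>\<phi>\<close> sends the elements of \<open>D\<close> with image in
  \<open>Q\<close> bijectively onto \<open>Q \<inter> D\<close>. These two sets of equal size cover
  \<open>D\<close>, and inclusion-exclusion gives the count. The two extra terms on the left measure
  exactly how far \<open>card D \<le> 2 * card Q\<close> is from equality.\<close>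

lemma card_transversal:
  assumes "finite D" "finite Q" and \<phi>: "bij_betw \<phi> D D"
    and cover: "\<And>d. d \<in> D \<Longrightarrow> d \<in> Q \<or> \<phi> d \<in> Q"
  shows "card D + card {d \<in> D. d \<in> Q \<and> \<phi> d \<in> Q} + 2 * card (Q - D) = 2 * card Q"
proof -
  let ?P = "{d \<in> D. \<phi> d \<in> Q}"
  have "bij_betw \<phi> ?P (Q \<inter> D)"
    using \<phi> unfolding bij_betw_def by (auto intro: inj_on_subset)
  then have P: "card ?P = card (Q \<inter> D)"
    by (rule bij_betw_same_card)
  have "card (Q \<inter> D) + card ?P = card ((Q \<inter> D) \<union> ?P) + card ((Q \<inter> D) \<inter> ?P)"
    using assms by (intro card_Un_Int) auto
  moreover have "(Q \<inter> D) \<union> ?P = D" "(Q \<inter> D) \<inter> ?P = {d \<in> D. d \<in> Q \<and> \<phi> d \<in> Q}"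
    using cover by auto
  moreover have "card Q = card (Q \<inter> D) + card (Q - D)"
    using assms by (metis card_Int_Diff)
  ultimately show ?thesis
    using P by simp
qed

text \<open>Only the absence of alternating 4-cycles is kept from forcing. The locale thus serves
  two purposes: the bound for an arbitrary \<open>G\<close>, and the edge count of the extremal
  graph.\<close>

locale paired_graph =
  fixes G :: "'a ugraph" and W :: "'a set" and p :: "'a \<Rightarrow> 'a"
  assumes simple: "simple_graph G"
    and W_subset: "W \<subseteq> verts G"
    and p_in: "x \<in> W \<Longrightarrow> p x \<in> W"
    and p_neq: "x \<in> W \<Longrightarrow> p x \<noteq> x"
    and p_p: "x \<in> W \<Longrightarrow> p (p x) = x"
    and p_adj: "x \<in> W \<Longrightarrow> adjacent G x (p x)"
    and no_alternating_4: "x \<in> W \<Longrightarrow> y \<in> W \<Longrightarrow> y \<noteq> x \<Longrightarrow> y \<noteq> p x \<Longrightarrow>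
      \<not> (adjacent G x y \<and> adjacent G (p x) (p y))"
begin

lemma finite_W: "finite W"
  using simple W_subset by (auto simp: simple_graph_def intro: finite_subset)

lemma p_eq_iff: "x \<in> W \<Longrightarrow> y \<in> W \<Longrightarrow> p x = p y \<longleftrightarrow> x = y"
  by (metis p_p)

lemma p_eq_swap: "x \<in> W \<Longrightarrow> y \<in> W \<Longrightarrow> p x = y \<longleftrightarrow> x = p y"
  by (metis p_p)

lemma card_cross_pairs: "card (cross_pairs W p) = card W * (card W - 2)"
proof -
  have "card (W - {x, p x}) = card W - 2" if "x \<in> W" for x
    using that p_in p_neq[OF that] by (subst card_Diff_subset) auto
  then show ?thesis
    unfolding cross_pairs_def using finite_W by (subst card_SigmaI) auto
qed

text \<open>This is \<open>card_transversal\<close> for the involution \<open>map_prod p p\<close>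
  on \<open>cross_pairs W p\<close>; the absence of alternating 4-cycles is the covering
  condition.\<close>

lemma card_nonadjacent_pairs:
  "card W * (card W - 2)
    + card {(x, y) \<in> cross_pairs W p. \<not> adjacent G x y \<and> \<not> adjacent G (p x) (p y)}
    + 2 * card (nonadjacent_pairs G - cross_pairs W p) = 2 * card (nonadjacent_pairs G)"
proof -
  let ?D = "cross_pairs W p" and ?Q = "nonadjacent_pairs G" and ?\<phi> = "map_prod p p"
  have \<phi>: "?\<phi> d \<in> ?D" "?\<phi> (?\<phi> d) = d" if "d \<in> ?D" for d
    using that by (auto simp: cross_pairs_def p_in p_p p_eq_iff p_eq_swap)
  have Q: "d \<in> ?Q \<longleftrightarrow> \<not> adjacent G (fst d) (snd d)" if "d \<in> ?D" for d
    using that W_subset by (auto simp: cross_pairs_def nonadjacent_pairs_def)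
  have "card ?D + card {d \<in> ?D. d \<in> ?Q \<and> ?\<phi> d \<in> ?Q} + 2 * card (?Q - ?D) = 2 * card ?Q"
  proof (rule card_transversal)
    show "finite ?D"
      using finite_W by (auto simp: cross_pairs_def)
    show "finite ?Q"
      using simple by (rule finite_nonadjacent_pairs)
    show "bij_betw ?\<phi> ?D ?D"
      by (rule bij_betw_byWitness[where f' = ?\<phi>]) (use \<phi> in auto)
    show "d \<in> ?Q \<or> ?\<phi> d \<in> ?Q" if "d \<in> ?D" for d
      using that no_alternating_4 \<phi> Q by (auto simp: cross_pairs_def)
  qed
  moreover have "{d \<in> ?D. d \<in> ?Q \<and> ?\<phi> d \<in> ?Q}
      = {(x, y) \<in> ?D. \<not> adjacent G x y \<and> \<not> adjacent G (p x) (p y)}"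
    using \<phi> Q by auto
  ultimately show ?thesis
    by (simp add: card_cross_pairs)
qed

lemma card_nonadjacent_pairs_ge: "card W * (card W - 2) \<le> 2 * card (nonadjacent_pairs G)"
  using card_nonadjacent_pairs by linarith

text \<open>Equality means that both extra terms of \<open>card_nonadjacent_pairs\<close> vanish,
  that is, that the two sets counted there are empty.\<close>

lemma card_nonadjacent_pairs_eq_iff:
  "2 * card (nonadjacent_pairs G) = card W * (card W - 2) \<longleftrightarrow>
    nonadjacent_pairs G \<subseteq> cross_pairs W p \<and>
    (\<forall>x\<in>W. \<forall>y\<in>W. y \<noteq> x \<longrightarrow> y \<noteq> p x \<longrightarrow> adjacent G x y \<or> adjacent G (p x) (p y))"
    (is "_ \<longleftrightarrow> _ \<and> ?one")
proof -
  let ?B = "{(x, y) \<in> cross_pairs W p. \<not> adjacent G x y \<and> \<not> adjacent G (p x) (p y)}"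
  have "finite ?B"
    by (rule finite_subset[where B = "W \<times> W"]) (use finite_W in \<open>auto simp: cross_pairs_def\<close>)
  then have "card ?B = 0 \<longleftrightarrow> ?one"
    by (auto simp: cross_pairs_def)
  moreover have "card (nonadjacent_pairs G - cross_pairs W p) = 0
      \<longleftrightarrow> nonadjacent_pairs G \<subseteq> cross_pairs W p"
    using finite_nonadjacent_pairs[OF simple] by auto
  ultimately show ?thesis
    using card_nonadjacent_pairs by linarith
qed

text \<open>Among the \<open>2 * n * (2 * n - 1)\<close> ordered pairs of distinct vertices, at
  least \<open>2 * m * (m - 1)\<close> are nonadjacent; halving the rest gives the bound, with
  equality exactly when the number of nonadjacent pairs is least possible.\<close>

lemma card_edges:
  assumes "card (verts G) = 2 * n" "card W = 2 * m" "m = n - k" "k \<le> n"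
  shows "int (card (edges G)) \<le> int n ^ 2 + 2 * int n * int k - int k ^ 2 - int k"
    and "int (card (edges G)) = int n ^ 2 + 2 * int n * int k - int k ^ 2 - int k \<longleftrightarrow>
      2 * card (nonadjacent_pairs G) = card W * (card W - 2)"
proof -
  have n: "int n = int m + int k"
    using assms by simp
  \<comment> \<open>The subtraction on naturals truncates when \<open>m = 0\<close>, but then the
    other factor is zero as well.\<close>
  have "int (card W * (card W - 2)) = 4 * int m * (int m - 1)"
    unfolding assms(2) by (cases m) (simp_all add: algebra_simps)
  then have W: "int (card W * (card W - 2)) = 4 * (int n - int k) * (int n - int k - 1)"
    using n by simp
  have "int (2 * n * (2 * n - 1)) = 2 * int n * (2 * int n - 1)"
    by (cases n) (simp_all add: algebra_simps)
  moreover have "int (2 * card (edges G) + card (nonadjacent_pairs G)) = int (2 * n * (2 * n - 1))"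
    using card_edges_nonadjacent_pairs[OF simple] assms(1) by simp
  ultimately have "2 * int (card (edges G)) + int (card (nonadjacent_pairs G))
      = 2 * int n * (2 * int n - 1)"
    by simp
  then have eq: "4 * int (card (edges G)) + 2 * int (card (nonadjacent_pairs G))
      = 4 * (int n ^ 2 + 2 * int n * int k - int k ^ 2 - int k) + int (card W * (card W - 2))"
    unfolding W by (simp add: algebra_simps power2_eq_square)
  \<comment> \<open>Once the nonlinear terms are named, only linear arithmetic is left.\<close>
  define c where "c = int (card W * (card W - 2))"
  define q where "q = int (card (nonadjacent_pairs G))"
  define b where "b = int n ^ 2 + 2 * int n * int k - int k ^ 2 - int k"
  have eq': "4 * int (card (edges G)) + 2 * q = 4 * b + c"
    using eq by (simp only: c_def q_def b_def)
  have c_q: "c \<le> 2 * q" "c = 2 * q \<longleftrightarrow> 2 * card (nonadjacent_pairs G) = card W * (card W - 2)"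
    using card_nonadjacent_pairs_ge unfolding c_def q_def by linarith+
  show "int (card (edges G)) \<le> int n ^ 2 + 2 * int n * int k - int k ^ 2 - int k"
    using eq' c_q(1) unfolding b_def[symmetric] by linarith
  show "int (card (edges G)) = int n ^ 2 + 2 * int n * int k - int k ^ 2 - int k \<longleftrightarrow>
      2 * card (nonadjacent_pairs G) = card W * (card W - 2)"
    using eq' c_q(2) unfolding b_def[symmetric] by linarith
qed

end

section \<open>The extremal graph\<close>

abbreviation extremal_graph :: "nat \<Rightarrow> nat \<Rightarrow> ((nat + nat) + nat) ugraph" where
  "extremal_graph m l \<equiv> graph_join (half_graph_hat m) (complete_graph l)"

lemma simple_extremal_graph: "simple_graph (extremal_graph m l)"
  by (intro simple_graph_join simple_graph_half_graph_hat simple_graph_complete_graph)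

lemma verts_extremal_graph:
  "verts (extremal_graph m l) = ({1..m} <+> {1..m}) <+> {1..l}"
  by (simp add: graph_join_def half_graph_hat_def half_graph_def complete_graph_def)

section \<open>Adjacency in the extremal graph\<close>

lemma image_eq_doubleton_iff:
  assumes "inj f"
  shows "{f x, f y} = f ` e \<longleftrightarrow> e = {x, y}"
  using inj_image_eq_iff[OF assms, of "{x, y}" e] by auto

lemma adjacent_join:
  "adjacent (graph_join G H) (Inl x) (Inl y) \<longleftrightarrow> adjacent G x y"
  "adjacent (graph_join G H) (Inr a) (Inr b) \<longleftrightarrow> adjacent H a b"
  "adjacent (graph_join G H) (Inl x) (Inr a) \<longleftrightarrow> x \<in> verts G \<and> a \<in> verts H"
  "adjacent (graph_join G H) (Inr a) (Inl x) \<longleftrightarrow> x \<in> verts G \<and> a \<in> verts H"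
proof -
  have l: "{Inl x, Inl y} = Inl ` e \<longleftrightarrow> e = {x, y}" for x y :: 'a and e
    by (simp add: image_eq_doubleton_iff)
  have r: "{Inr x, Inr y} = Inr ` e \<longleftrightarrow> e = {x, y}" for x y :: 'b and e
    by (simp add: image_eq_doubleton_iff)
  have ne: "{Inl x, Inr y} \<noteq> Inl ` e" "{Inl x, Inr y} \<noteq> Inr ` e'"
      "{Inr y, Inl x} \<noteq> Inl ` e" "{Inr y, Inl x} \<noteq> Inr ` e'"
      "{Inl x, Inl x'} \<noteq> Inr ` e'" "{Inr y, Inr y'} \<noteq> Inl ` e"
    for x x' :: 'a and y y' :: 'b and e e'
    by blast+
  show "adjacent (graph_join G H) (Inl x) (Inl y) \<longleftrightarrow> adjacent G x y"
    by (auto simp: graph_join_def image_iff l ne doubleton_eq_iff)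
  show "adjacent (graph_join G H) (Inr a) (Inr b) \<longleftrightarrow> adjacent H a b"
    by (auto simp: graph_join_def image_iff r ne doubleton_eq_iff)
  show "adjacent (graph_join G H) (Inl x) (Inr a) \<longleftrightarrow> x \<in> verts G \<and> a \<in> verts H"
    by (auto simp: graph_join_def image_iff ne doubleton_eq_iff)
  show "adjacent (graph_join G H) (Inr a) (Inl x) \<longleftrightarrow> x \<in> verts G \<and> a \<in> verts H"
    by (auto simp: graph_join_def image_iff ne doubleton_eq_iff)
qed

lemma adjacent_half_graph_hat:
  "\<not> adjacent (half_graph_hat m) (Inl i) (Inl j)"
  "adjacent (half_graph_hat m) (Inl i) (Inr j) \<longleftrightarrow> i \<in> {1..m} \<and> j \<in> {1..m} \<and> j \<le> i"
  "adjacent (half_graph_hat m) (Inr i) (Inl j) \<longleftrightarrow> i \<in> {1..m} \<and> j \<in> {1..m} \<and> i \<le> j"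
  "adjacent (half_graph_hat m) (Inr i) (Inr j) \<longleftrightarrow> i \<in> {1..m} \<and> j \<in> {1..m} \<and> i \<noteq> j"
  by (auto simp: half_graph_hat_def half_graph_def doubleton_eq_iff)

lemma adjacent_complete_graph:
  "adjacent (complete_graph l) i j \<longleftrightarrow> i \<in> {1..l} \<and> j \<in> {1..l} \<and> i \<noteq> j"
  by (auto simp: complete_graph_def card_insert_if)

lemmas adjacent_extremal_graph =
  adjacent_join adjacent_half_graph_hat adjacent_complete_graph

lemma verts_half_graph_hat: "verts (half_graph_hat m) = {1..m} <+> {1..m}"
  by (simp add: half_graph_hat_def half_graph_def)

lemma verts_complete_graph: "verts (complete_graph l) = {1..l}"
  by (simp add: complete_graph_def)

text \<open>Pairs \<open>u_i\<close> with \<open>v_i\<close>, an edge of the half graph; on the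
  complete part the identity is a default value.\<close>

definition extremal_partner :: "(nat + nat) + nat \<Rightarrow> (nat + nat) + nat" where
  "extremal_partner = map_sum (case_sum Inr Inl) id"

lemma extremal_partner_simps [simp]:
  "extremal_partner (Inl (Inl i)) = Inl (Inr i)"
  "extremal_partner (Inl (Inr i)) = Inl (Inl i)"
  "extremal_partner (Inr j) = Inr j"
  by (simp_all add: extremal_partner_def)

text \<open>With \<open>W\<close> the vertices of the half graph, the extremal graph attains the
  least number of nonadjacent pairs: for \<open>i \<noteq> j\<close>, the pair
  \<open>v_i v_j\<close> is adjacent and \<open>u_i u_j\<close> is not, and exactly one of
  \<open>u_i v_j\<close> and \<open>v_i u_j\<close> is adjacent. All vertices of the complete part
  are adjacent to everything else.\<close>

lemma card_edges_extremal_graph: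
  assumes "k < n"
  shows "int (card (edges (extremal_graph (n - k) (2 * k))))
    = int n ^ 2 + 2 * int n * int k - int k ^ 2 - int k"
proof -
  let ?m = "n - k"
  let ?H = "extremal_graph ?m (2 * k)" and ?W = "Inl ` ({1..?m} <+> {1..?m}) :: ((nat + nat) + nat) set"
  interpret paired_graph ?H ?W extremal_partner
  proof
    show "simple_graph ?H"
      by (rule simple_extremal_graph)
  qed (auto simp: verts_extremal_graph adjacent_extremal_graph)
  have V: "card (verts ?H) = 2 * n"
    using assms by (simp add: verts_extremal_graph card_Plus)
  have W: "card ?W = 2 * ?m"
    by (simp add: card_image card_Plus)
  have "2 * card (nonadjacent_pairs ?H) = card ?W * (card ?W - 2)"
    unfolding card_nonadjacent_pairs_eq_iff
    by (auto simp: nonadjacent_pairs_def cross_pairs_def verts_extremal_graph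
        adjacent_extremal_graph verts_half_graph_hat verts_complete_graph)
  then show ?thesis
    using card_edges(2)[OF V W] assms by simp
qed

section \<open>Structure in the case of equality\<close>

text \<open>The three forbidden adjacencies close the alternating cycle
  \<open>x, p y, y, p z, z, p x\<close>. The last two assumptions are the equality condition of
  \<open>card_nonadjacent_pairs_eq_iff\<close>.\<close>

locale tight_paired_graph = paired_graph +
  assumes no_alternating_6: "x \<in> W \<Longrightarrow> y \<in> W \<Longrightarrow> z \<in> W \<Longrightarrow> y \<notin> {x, p x} \<Longrightarrow> z \<notin> {x, p x, y, p y} \<Longrightarrow>
      \<not> (adjacent G x (p y) \<and> adjacent G y (p z) \<and> adjacent G z (p x))"
    and nonadjacent_cross: "nonadjacent_pairs G \<subseteq> cross_pairs W p"
    and adjacent_or: "x \<in> W \<Longrightarrow> y \<in> W \<Longrightarrow> y \<noteq> x \<Longrightarrow> y \<noteq> p x \<Longrightarrow>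
      adjacent G x y \<or> adjacent G (p x) (p y)"
begin

section \<open>Domination between matching edges\<close>

lemma adjacent_p_iff:
  assumes "x \<in> W" "y \<in> W" "y \<noteq> x" "y \<noteq> p x"
  shows "adjacent G (p x) (p y) \<longleftrightarrow> \<not> adjacent G x y"
  using adjacent_or[OF assms] no_alternating_4[OF assms] by blast

lemma adjacent_outside:
  assumes "x \<in> verts G" "y \<in> verts G" "x \<noteq> y" "x \<notin> W \<or> y \<notin> W"
  shows "adjacent G x y"
  using nonadjacent_cross assms by (auto simp: nonadjacent_pairs_def cross_pairs_def)

text \<open>The vertex \<open>x\<close> is adjacent to both ends of another matching edge
  \<open>{y, p y}\<close>. The edge is represented by either end, which keeps the relation on
  vertices.\<close>

definition dominates :: "'a \<Rightarrow> 'a \<Rightarrow> bool" where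
  "dominates x y \<longleftrightarrow> x \<in> W \<and> y \<in> W \<and> y \<noteq> x \<and> y \<noteq> p x \<and> adjacent G x y \<and> adjacent G x (p y)"

lemma dominates_p: "dominates x y \<Longrightarrow> dominates x (p y)"
  by (auto simp: dominates_def p_in p_p p_eq_iff p_eq_swap)

text \<open>Of the four pairs between two matching edges, exactly one of \<open>x y\<close>,
  \<open>p x p y\<close> and exactly one of \<open>x (p y)\<close>, \<open>p x y\<close> is
  adjacent. The two adjacent pairs share a vertex, and that vertex dominates.\<close>

lemma dominates_cases:
  assumes "x \<in> W" "y \<in> W" "y \<noteq> x" "y \<noteq> p x"
  shows "dominates x y \<or> dominates (p x) y \<or> dominates y x \<or> dominates (p y) x"
  using assms adjacent_p_iff[of x y] adjacent_p_iff[of x "p y"]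
  by (auto simp: dominates_def p_in p_p p_eq_iff p_eq_swap insert_commute)

lemma dominates_asym: "dominates x y \<Longrightarrow> \<not> dominates y (p x)"
  using adjacent_p_iff[of x "p y"]
  by (auto simp: dominates_def p_in p_p p_eq_iff p_eq_swap insert_commute)

text \<open>Every matching edge therefore has an end that dominates nothing. If both ends dominated,
  an alternating 4-cycle would arise when \<open>y\<close> and \<open>z\<close> lie in the same
  matching edge, and an alternating 6-cycle otherwise.\<close>

lemma not_both_ends_dominate:
  assumes "dominates x y" "dominates (p x) z"
  shows False
proof -
  have in_W: "x \<in> W" "y \<in> W" "z \<in> W"
    using assms by (auto simp: dominates_def)
  consider "z = y" | "z = p y" | "z \<notin> {y, p y}"
    by auto
  then show False
  proof cases
    case 1
    then show False
      using assms adjacent_p_iff[of x y] by (auto simp: dominates_def)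
  next
    case 2
    then show False
      using assms adjacent_p_iff[of x y] by (auto simp: dominates_def)
  next
    case 3
    \<comment> \<open>The alternating cycle is \<open>x, p y, y, z, p z, p x\<close>.\<close>
    have six: False if "dominates x y" "dominates (p x) z" "adjacent G y z" "z \<notin> {y, p y}" for y z
      using that no_alternating_6[of x y "p z"]
      by (auto simp: dominates_def p_in p_p p_eq_iff p_eq_swap insert_commute)
    have "adjacent G y z \<or> adjacent G (p y) (p z)"
      using adjacent_or[of y z] in_W 3 by auto
    then show False
    proof
      assume "adjacent G y z"
      then show False
        using six assms 3 by blast
    next
      \<comment> \<open>Domination is unchanged when \<open>y\<close> and \<open>z\<close> are
        replaced by their partners, so the same cycle argument applies.\<close>
      assume "adjacent G (p y) (p z)"
      then show False
        using six[of "p y" "p z"] dominates_p assms 3 in_W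
        by (auto simp: p_p p_eq_iff p_eq_swap)
    qed
  qed
qed

text \<open>Each domination provides one of the three edges \<open>x (p y)\<close>,
  \<open>y (p z)\<close>, \<open>z (p x)\<close> of an alternating 6-cycle; if
  \<open>z = p x\<close>, only two matching edges are involved and asymmetry applies.\<close>

lemma dominates_no_3_cycle:
  assumes "dominates x y" "dominates y z" "dominates z x"
  shows False
proof (cases "z = p x")
  case True
  then show False
    using assms dominates_asym by blast
next
  case False
  then show False
    using assms no_alternating_6[of x y z] by (auto simp: dominates_def p_p p_eq_iff p_eq_swap)
qed

text \<open>Picks from each matching edge the end that is to become some \<open>v_i\<close>; its
  partner dominates nothing and is to become \<open>u_i\<close>.\<close>

lemma extremal_transversal:
  obtains X where "X \<subseteq> W" "p ` X = W - X"
    "\<And>x y. x \<in> X \<Longrightarrow> \<not> dominates (p x) y"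
proof -
  \<comment> \<open>The choice depends on the matching edge as a set, so both of its ends yield the
    same vertex.\<close>
  define c where "c e = (SOME x. x \<in> e \<and> (\<forall>y. \<not> dominates (p x) y))" for e
  define X where "X = {x \<in> W. c {x, p x} = x}"
  have c: "c {x, p x} \<in> {x, p x} \<and> (\<forall>y. \<not> dominates (p (c {x, p x})) y)" if "x \<in> W" for x
    unfolding c_def
  proof (rule someI_ex)
    show "\<exists>z. z \<in> {x, p x} \<and> (\<forall>y. \<not> dominates (p z) y)"
      using not_both_ends_dominate[of x] p_p[OF that] by (metis insertCI)
  qed
  show thesis
  proof
    show "X \<subseteq> W"
      by (auto simp: X_def)
    have "p x \<in> W - X" if "x \<in> X" for x
      using that p_neq[of x] by (auto simp: X_def p_in p_p insert_commute)
    moreover have "p x \<in> X" if "x \<in> W - X" for x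
      using that c[of x] by (auto simp: X_def p_in p_p insert_commute)
    ultimately show "p ` X = W - X"
      using p_p by (force simp: image_iff)
    show "\<not> dominates (p x) y" if "x \<in> X" for x y
      using c[of x] that by (auto simp: X_def)
  qed
qed

text \<open>Domination is a strict linear order on the chosen ends \<open>X\<close>. The rank of
  \<open>x\<close> in it is the common index of \<open>x\<close> and \<open>p x\<close>, and the
  vertices outside \<open>W\<close> form the complete part.\<close>

lemma graph_iso_extremal_graph:
  assumes "card W = 2 * m" "card (verts G) = 2 * m + l"
  shows "graph_iso G (extremal_graph m l)"
proof -
  obtain X where X: "X \<subseteq> W" and p_X: "p ` X = W - X"
    and X_dom: "\<And>x y. x \<in> X \<Longrightarrow> \<not> dominates (p x) y"
    by (rule extremal_transversal) blast
  have X_W: "x \<in> W" if "x \<in> X" for x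
    using X that by auto
  have fin_X: "finite X"
    using X finite_W by (rule finite_subset)
  have X_p: "p x \<notin> X" if "x \<in> X" for x
    using p_X that by blast
  have "inj_on p X"
    by (auto simp: inj_on_def X_W p_eq_iff)
  then have "card (W - X) = card X"
    using card_image[of p X] p_X by simp
  then have card_X: "card X = m"
    using assms card_Diff_subset[OF fin_X X] card_mono[OF finite_W X] by simp
  \<comment> \<open>The partners \<open>p x\<close> and \<open>p y\<close> dominate nothing, which
    rules out two of the four cases.\<close>
  have total: "dominates x y \<or> dominates y x" if "x \<in> X" "y \<in> X" "x \<noteq> y" for x y
  proof -
    have "y \<noteq> p x"
      using that X_p X_W by blast
    then show ?thesis
      using dominates_cases[of x y] that X_W X_dom by auto
  qed
  have asym: "\<not> dominates y x" if "dominates x y" for x y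
    using that dominates_asym dominates_p by blast
  \<comment> \<open>A tournament without 3-cycles is transitive.\<close>
  have trans: "dominates x z" if "dominates x y" "dominates y z" "x \<in> X" "y \<in> X" "z \<in> X" for x y z
  proof -
    have "x \<noteq> z"
      using that asym by blast
    then show ?thesis
      using that total[of x z] dominates_no_3_cycle by blast
  qed
  \<comment> \<open>Counting \<open>x\<close> itself makes the ranks start at 1, as the indices of
    the half graph do.\<close>
  define r where "r x = card {y \<in> X. dominates y x \<or> y = x}" for x
  have r_less: "r x < r y" if "dominates x y" "x \<in> X" "y \<in> X" for x y
    unfolding r_def
  proof (rule psubset_card_mono)
    show "finite {z \<in> X. dominates z y \<or> z = y}"
      using fin_X by simp
    have "y \<notin> {z \<in> X. dominates z x \<or> z = x}"
      using that asym by (auto simp: dominates_def)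
    then show "{z \<in> X. dominates z x \<or> z = x} \<subset> {z \<in> X. dominates z y \<or> z = y}"
      using that trans by blast
  qed
  have r_inj: "x = y" if "r x = r y" "x \<in> X" "y \<in> X" for x y
    using that total[of x y] r_less[of x y] r_less[of y x] by auto
  have r_range: "r ` X \<subseteq> {1..m}"
  proof
    fix i assume "i \<in> r ` X"
    then obtain x where x: "x \<in> X" "i = r x"
      by auto
    have "card {x} \<le> r x"
      unfolding r_def using fin_X x by (intro card_mono) auto
    moreover have "r x \<le> card X"
      unfolding r_def using fin_X by (intro card_mono) auto
    ultimately show "i \<in> {1..m}"
      using x card_X by simp
  qed
  have r_bij: "r ` X = {1..m}"
    using r_inj r_range card_X by (intro card_subset_eq) (auto simp: card_image inj_on_def)
  have "finite (verts G)"
    using simple by (simp add: simple_graph_def)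
  then have "card (verts G - W) = card {1..l}"
    using card_Diff_subset[OF finite_W W_subset] assms by simp
  then obtain h where h: "bij_betw h (verts G - W) {1..l}"
    using \<open>finite (verts G)\<close> by (metis finite_Diff finite_atLeastAtMost finite_same_card_bij)
  define f where "f x = (if x \<in> X then Inl (Inr (r x)) else if x \<in> W then Inl (Inl (r (p x))) else Inr (h x))" for x
  have f: "f x = Inl (Inr (r x))" "f (p x) = Inl (Inl (r x))" if "x \<in> X" for x
    using that X_p[OF that] by (auto simp: f_def X_W p_in p_p)
  have f_out: "f x = Inr (h x)" if "x \<in> verts G - W" for x
    using that X_W by (auto simp: f_def)
  have r_in: "r x \<in> {1..m}" if "x \<in> X" for x
    using that r_range by auto
  have h_in: "Suc 0 \<le> h x" "h x \<le> l" if "x \<in> verts G" "x \<notin> W" for x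
    using that h by (auto simp: bij_betw_def)
  have h_inj: "h x = h y \<longleftrightarrow> x = y" if "x \<in> verts G - W" "y \<in> verts G - W" for x y
    using that h by (auto simp: bij_betw_def inj_on_def)
  have V_cases: "thesis" if "x \<in> verts G" "x \<in> X \<Longrightarrow> thesis"
      "\<And>y. y \<in> X \<Longrightarrow> x = p y \<Longrightarrow> thesis" "x \<in> verts G - W \<Longrightarrow> thesis" for x thesis
    using that p_X by blast
  have V_un: "verts G = X \<union> p ` X \<union> (verts G - W)"
    using p_X X W_subset by blast
  have bij: "bij_betw f (verts G) (verts (extremal_graph m l))"
    unfolding bij_betw_def
  proof
    show "inj_on f (verts G)"
    proof (rule inj_onI)
      fix x y assume "x \<in> verts G" "y \<in> verts G" and eq: "f x = f y"
      then show "x = y"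
        by (elim V_cases[of x] V_cases[of y]) (auto simp: f f_out h_inj dest: r_inj)
    qed
    have "f ` verts G = f ` X \<union> f ` p ` X \<union> f ` (verts G - W)"
      using V_un by (metis image_Un)
    also have "f ` X = (\<lambda>i. Inl (Inr i)) ` r ` X"
      by (auto simp: f image_image)
    also have "f ` p ` X = (\<lambda>i. Inl (Inl i)) ` r ` X"
      by (auto simp: f image_image)
    also have "f ` (verts G - W) = Inr ` h ` (verts G - W)"
      by (auto simp: f_out image_image)
    finally show "f ` verts G = verts (extremal_graph m l)"
      using r_bij h by (auto simp: verts_extremal_graph bij_betw_def)
  qed
  \<comment> \<open>Of two vertices of \<open>X\<close> one dominates the other, so \<open>X\<close>
    is a clique like the \<open>v_i\<close>; by \<open>adjacent_p_iff\<close> the partners are then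
    independent like the \<open>u_i\<close>.\<close>
  have XX: "adjacent G x y \<longleftrightarrow> r x \<noteq> r y" if "x \<in> X" "y \<in> X" for x y
  proof (cases "x = y")
    case True
    then show ?thesis
      using adjacent_irrefl[OF simple, of x] by simp
  next
    case False
    then have "adjacent G x y"
      using that total[of x y] by (auto simp: dominates_def insert_commute)
    then show ?thesis
      using False r_inj that by blast
  qed
  have pp: "\<not> adjacent G (p x) (p y)" if "x \<in> X" "y \<in> X" for x y
  proof (cases "x = y")
    case True
    then show ?thesis
      using adjacent_irrefl[OF simple] by simp
  next
    case False
    moreover have "y \<noteq> p x"
      using that X_p X_W by blast
    ultimately show ?thesis
      using that XX[OF that] adjacent_p_iff[of x y] X_W r_inj by blast
  qed
  \<comment> \<open>If \<open>y\<close> dominates \<open>x\<close>, then \<open>y\<close> is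
    adjacent to \<open>p x\<close>. If \<open>x\<close> dominates \<open>y\<close>, then
    \<open>x\<close> is adjacent to \<open>p y\<close>, which excludes the opposite pair
    \<open>p x\<close>, \<open>y\<close>.\<close>
  have pX: "adjacent G (p x) y \<longleftrightarrow> r y \<le> r x" if "x \<in> X" "y \<in> X" for x y
  proof -
    consider "x = y" | "dominates y x" | "dominates x y"
      using total \<open>x \<in> X\<close> \<open>y \<in> X\<close> by blast
    then show ?thesis
    proof cases
      case 1
      then show ?thesis
        using p_adj X_W that by (auto simp: insert_commute)
    next
      case 2
      then show ?thesis
        using r_less[OF 2] that by (auto simp: dominates_def insert_commute)
    next
      case 3
      then have "\<not> adjacent G (p x) y"
        using adjacent_p_iff[of x "p y"]
        by (auto simp: dominates_def p_in p_p p_eq_iff p_eq_swap)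
      then show ?thesis
        using r_less[OF 3] that by auto
    qed
  qed
  have Xp: "adjacent G y (p x) \<longleftrightarrow> r y \<le> r x" if "x \<in> X" "y \<in> X" for x y
    using pX[OF that] by (simp add: insert_commute)
  have out: "adjacent G x y \<longleftrightarrow> x \<noteq> y" if "x \<in> verts G" "y \<in> verts G" "x \<notin> W \<or> y \<notin> W" for x y
    using that adjacent_outside adjacent_irrefl[OF simple] by blast
  have "adjacent G x y \<longleftrightarrow> adjacent (extremal_graph m l) (f x) (f y)"
    if "x \<in> verts G" "y \<in> verts G" for x y
  proof (cases "x \<in> W \<and> y \<in> W")
    case True
    then show ?thesis
      using that by (elim V_cases[of x] V_cases[of y])
        (auto simp: f adjacent_extremal_graph XX pp pX Xp dest: r_in)
  next
    case False
    then have "adjacent G x y \<longleftrightarrow> x \<noteq> y"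
      using out that by blast
    then show ?thesis
      using that False p_in X_W by (elim V_cases[of x] V_cases[of y])
        (auto simp: f f_out h_inj adjacent_extremal_graph verts_half_graph_hat
          verts_complete_graph h_in dest: r_in)
  qed
  then show ?thesis
    unfolding graph_iso_def using bij by blast
qed

end

section \<open>Forcing sets\<close>

text \<open>Switching along alternating cycles: \<open>A\<close> holds their matching edges and
  \<open>B\<close> the others. At a vertex covered by \<open>B\<close> the only edge of
  \<open>M\<close> lies in \<open>A\<close> and is removed; elsewhere nothing changes.\<close>

lemma perfect_matching_exchange:
  assumes M: "perfect_matching G M" and "A \<subseteq> M" "B \<subseteq> edges G" "\<Union>A = \<Union>B" "pairwise disjnt B"
  shows "perfect_matching G (M - A \<union> B)"
  unfolding perfect_matching_def
proof (intro conjI ballI)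
  show "M - A \<union> B \<subseteq> edges G"
    using M assms(3) by (auto simp: perfect_matching_def)
  fix v assume "v \<in> verts G"
  then have ex1: "\<exists>!e. e \<in> M \<and> v \<in> e"
    using M by (auto simp: perfect_matching_def)
  show "\<exists>!e. e \<in> M - A \<union> B \<and> v \<in> e"
  proof (cases "v \<in> \<Union>B")
    case True
    moreover from this have "v \<in> \<Union>A"
      using assms(4) by simp
    ultimately obtain e e' where e: "e \<in> A" "v \<in> e" and e': "e' \<in> B" "v \<in> e'"
      by blast
    have "d \<in> A" if "d \<in> M" "v \<in> d" for d
    proof -
      have "d = e"
        using ex1 e(2) that subsetD[OF assms(2) e(1)] by blast
      then show ?thesis
        using e(1) by simp
    qed
    moreover have "d = e'" if "d \<in> B" "v \<in> d" for d
      using pairwiseD[OF assms(5) that(1) e'(1)] that(2) e'(2) by (auto simp: disjnt_iff)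
    ultimately show ?thesis
      using e' by blast
  next
    case False
    moreover from this have "v \<notin> \<Union>A"
      using assms(4) by simp
    ultimately have "e \<in> M - A \<union> B \<and> v \<in> e \<longleftrightarrow> e \<in> M \<and> v \<in> e" for e
      by blast
    then show ?thesis
      using ex1 by simp
  qed
qed

text \<open>The switched matching still contains \<open>S\<close>, hence equals \<open>M\<close>. An
  alternating cycle avoiding \<open>S\<close> is refuted by an edge of \<open>B\<close> outside
  \<open>M\<close>.\<close>

lemma forcing_set_exchange:
  assumes "perfect_matching G M" "forcing_set G M S"
    and "A \<subseteq> M" "A \<inter> S = {}" "B \<subseteq> edges G" "\<Union>A = \<Union>B" "pairwise disjnt B"
  shows "B \<subseteq> M"
proof -
  have "perfect_matching G (M - A \<union> B)"
    using assms(1,3,5-7) by (rule perfect_matching_exchange)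
  moreover have "S \<subseteq> M"
    using assms(2) unfolding forcing_set_def by blast
  then have "S \<subseteq> M - A \<union> B"
    using assms(4) by blast
  ultimately have "M - A \<union> B = M"
    using assms(2) unfolding forcing_set_def by blast
  then show ?thesis
    using Un_upper2[of B "M - A"] by simp
qed

section \<open>Minimum forcing sets and partner maps\<close>

lemma forcing_set_self:
  assumes "simple_graph G" "perfect_matching G M"
  shows "forcing_set G M M"
  unfolding forcing_set_def
proof (intro conjI allI impI)
  fix M' assume M': "perfect_matching G M' \<and> M \<subseteq> M'"
  have "e \<in> M" if "e \<in> M'" for e
  proof -
    have "e \<in> edges G"
      using that M' by (auto simp: perfect_matching_def)
    then have "e \<subseteq> verts G" "card e = 2"
      using assms(1) by (auto simp: simple_graph_def)
    then obtain v where v: "v \<in> e" "v \<in> verts G"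
      by (auto simp: card_2_iff)
    then obtain e' where e': "e' \<in> M" "v \<in> e'"
      using assms(2) unfolding perfect_matching_def by blast
    have "\<exists>!d. d \<in> M' \<and> v \<in> d"
      using M' v(2) by (simp add: perfect_matching_def)
    then have "e = e'"
      using that M' v(1) e' by blast
    then show ?thesis
      using e' by simp
  qed
  then show "M' = M"
    using M' by blast
qed simp

text \<open>Both minima are attained: a perfect matching exists, and each one is a forcing set of
  itself.\<close>

lemma min_forcing_set:
  assumes "simple_graph G" "\<exists>M. perfect_matching G M"
  obtains M S where "perfect_matching G M" "forcing_set G M S" "card S = min_forcing_number G"
proof -
  have "\<exists>s M. perfect_matching G M \<and> forcing_number G M = s"
    using assms(2) by blast
  then have "\<exists>M. perfect_matching G M \<and> forcing_number G M = min_forcing_number G"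
    unfolding min_forcing_number_def by (rule LeastI_ex)
  then obtain M where M: "perfect_matching G M" "forcing_number G M = min_forcing_number G"
    by blast
  have "\<exists>s S. forcing_set G M S \<and> card S = s"
    using forcing_set_self[OF assms(1) M(1)] by blast
  then have "\<exists>S. forcing_set G M S \<and> card S = forcing_number G M"
    unfolding forcing_number_def by (rule LeastI_ex)
  then show thesis
    using that M by auto
qed

lemma perfect_matching_partner:
  assumes "simple_graph G" "perfect_matching G M"
  obtains p where
    "\<And>x. x \<in> verts G \<Longrightarrow> {x, p x} \<in> M \<and> p x \<in> verts G \<and> p x \<noteq> x \<and> p (p x) = x"
    "\<And>x y. {x, y} \<in> M \<Longrightarrow> y = p x"
proof -
  have M: "M \<subseteq> edges G" and ex1: "\<And>v. v \<in> verts G \<Longrightarrow> \<exists>!e. e \<in> M \<and> v \<in> e"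
    using assms(2) by (auto simp: perfect_matching_def)
  have edge: "e \<subseteq> verts G" "card e = 2" if "e \<in> M" for e
    using assms(1) M that by (auto simp: simple_graph_def)
  have "\<exists>y. {x, y} \<in> M" if x: "x \<in> verts G" for x
  proof -
    obtain e where "e \<in> M" "x \<in> e"
      using ex1[OF x] by blast
    moreover then obtain a b where "e = {a, b}"
      using edge(2) by (metis card_2_iff)
    ultimately show ?thesis
      by (auto simp: insert_commute)
  qed
  then obtain p where p: "\<And>x. x \<in> verts G \<Longrightarrow> {x, p x} \<in> M"
    by metis
  have neq: "x \<noteq> y" if "{x, y} \<in> M" for x y
    using edge(2)[OF that] by auto
  have uniq: "y = p x" if "{x, y} \<in> M" for x y
  proof -
    have "x \<in> verts G"
      using edge(1)[OF that] by simp
    then have "{x, y} = {x, p x}"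
      using ex1 that p by blast
    then show ?thesis
      by (auto simp: doubleton_eq_iff)
  qed
  show thesis
  proof
    show "{x, p x} \<in> M \<and> p x \<in> verts G \<and> p x \<noteq> x \<and> p (p x) = x" if "x \<in> verts G" for x
      using p[OF that] edge(1)[OF p[OF that]] neq[OF p[OF that]] uniq[of "p x" x]
      by (auto simp: insert_commute)
  qed (rule uniq)
qed

lemma card_Union_matching:
  assumes "simple_graph G" "perfect_matching G M" "S \<subseteq> M"
  shows "card (\<Union>S) = 2 * card S"
proof -
  have edge: "e \<subseteq> verts G" "card e = 2" if "e \<in> S" for e
    using assms that by (auto simp: simple_graph_def perfect_matching_def)
  have "e \<inter> e' = {}" if e: "e \<in> S" "e' \<in> S" "e \<noteq> e'" for e e'
  proof (rule ccontr)
    assume "e \<inter> e' \<noteq> {}"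
    then obtain v where v: "v \<in> e" "v \<in> e'"
      by blast
    then have "\<exists>!d. d \<in> M \<and> v \<in> d"
      using assms(2) edge(1)[OF e(1)] unfolding perfect_matching_def by blast
    then show False
      using v e assms(3) by blast
  qed
  then have "pairwise disjnt S"
    by (auto simp: pairwise_def disjnt_def)
  then have "card (\<Union>S) = sum card S"
    using edge(2) by (intro card_Union_disjoint) (auto intro: card_ge_0_finite)
  then show ?thesis
    using edge(2) by simp
qed

section \<open>The bound and its extremal graphs\<close>

theorem theorem2p1:
  fixes G :: "'a ugraph" and n k :: nat
  assumes "simple_graph G"
    and "card (verts G) = 2 * n"
    and "\<exists>M. perfect_matching G M"
    and "min_forcing_number G = k"
    and "k < n"
  shows "int (card (edges G)) \<le> int n ^ 2 + 2 * int n * int k - int k ^ 2 - int k \<and>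
    (int (card (edges G)) = int n ^ 2 + 2 * int n * int k - int k ^ 2 - int k \<longleftrightarrow>
     graph_iso G (graph_join (half_graph_hat (n - k)) (complete_graph (2 * k))))"
proof -
  obtain M S where M: "perfect_matching G M" and S: "forcing_set G M S" and card_S: "card S = k"
    using min_forcing_set[OF assms(1,3)] assms(4) by metis
  obtain p where p: "\<And>x. x \<in> verts G \<Longrightarrow> {x, p x} \<in> M \<and> p x \<in> verts G \<and> p x \<noteq> x \<and> p (p x) = x"
    and M_p: "\<And>x y. {x, y} \<in> M \<Longrightarrow> y = p x"
    by (rule perfect_matching_partner[OF assms(1) M]) blast
  have M_edges: "M \<subseteq> edges G" and S_M: "S \<subseteq> M"
    using M S unfolding perfect_matching_def forcing_set_def by blast+
  have S_verts: "\<Union>S \<subseteq> verts G"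
    using assms(1) M_edges S_M by (auto simp: simple_graph_def)
  define W where "W = verts G - \<Union>S"
  have W: "x \<in> verts G" "{x, p x} \<in> M" "p x \<noteq> x" "p (p x) = x" "{x, p x} \<notin> S" if "x \<in> W" for x
    using that p by (auto simp: W_def)
  \<comment> \<open>An edge of \<open>S\<close> at \<open>p x\<close> would be the matching edge
    \<open>{x, p x}\<close>, and then \<open>S\<close> would cover \<open>x\<close>.\<close>
  have p_W: "p x \<in> W" if "x \<in> W" for x
  proof -
    have "p x \<notin> e" if "e \<in> S" for e
    proof
      assume "p x \<in> e"
      moreover have "e \<in> M"
        using \<open>e \<in> S\<close> S_M by auto
      moreover have "\<exists>!d. d \<in> M \<and> p x \<in> d"
        using M p[OF W(1)[OF \<open>x \<in> W\<close>]] by (simp add: perfect_matching_def)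
      ultimately have "e = {x, p x}"
        using W(2)[OF \<open>x \<in> W\<close>] by blast
      then show False
        using W[OF \<open>x \<in> W\<close>] \<open>e \<in> S\<close> by simp
    qed
    then show ?thesis
      using W[OF that] p by (auto simp: W_def)
  qed
  interpret paired_graph G W p
  proof
    show "\<not> (adjacent G x y \<and> adjacent G (p x) (p y))"
      if "x \<in> W" "y \<in> W" "y \<noteq> x" "y \<noteq> p x" for x y
    proof
      assume adj: "adjacent G x y \<and> adjacent G (p x) (p y)"
      have neq: "x \<noteq> p x" "y \<noteq> p y" "x \<noteq> p y" "p x \<noteq> p y"
        using that W(3,4)[of x] W(3,4)[of y] by metis+
      \<comment> \<open>Switching along the 4-cycle avoids \<open>S\<close> because both matching
        edges lie in \<open>W\<close>; the result would make \<open>y\<close> the partner of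
        \<open>x\<close>.\<close>
      have "{{x, y}, {p x, p y}} \<subseteq> M"
      proof (rule forcing_set_exchange[OF M S])
        show "{{x, p x}, {y, p y}} \<subseteq> M" "{{x, p x}, {y, p y}} \<inter> S = {}"
          using W(2,5) that by simp_all
        show "\<Union>{{x, p x}, {y, p y}} = \<Union>{{x, y}, {p x, p y}}"
          by (simp add: insert_commute)
      qed (use adj neq that in \<open>auto simp: pairwise_insert disjnt_def\<close>)
      then show False
        using M_p[of x y] that by simp
    qed
  qed (use assms(1) W p_W M_edges in \<open>auto simp: W_def\<close>)
  have no6: "\<not> (adjacent G x (p y) \<and> adjacent G y (p z) \<and> adjacent G z (p x))"
    if "x \<in> W" "y \<in> W" "z \<in> W" "y \<notin> {x, p x}" "z \<notin> {x, p x, y, p y}" for x y z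
  proof
    assume adj: "adjacent G x (p y) \<and> adjacent G y (p z) \<and> adjacent G z (p x)"
    have swap: "a \<noteq> p b" if "a \<in> W" "b \<in> W" "b \<noteq> p a" for a b
      using that p_p[of b] by auto
    have neq: "x \<noteq> p x" "y \<noteq> p y" "z \<noteq> p z" "x \<noteq> y" "x \<noteq> z" "y \<noteq> z"
        "x \<noteq> p y" "x \<noteq> p z" "y \<noteq> p x" "y \<noteq> p z" "z \<noteq> p x" "z \<noteq> p y"
        "p x \<noteq> p y" "p x \<noteq> p z" "p y \<noteq> p z"
      using that p_neq[of x] p_neq[of y] p_neq[of z] swap[of x y] swap[of x z] swap[of y z]
        p_eq_iff[of x y] p_eq_iff[of x z] p_eq_iff[of y z]
      by auto
    have "{{x, p y}, {y, p z}, {z, p x}} \<subseteq> M"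
    proof (rule forcing_set_exchange[OF M S])
      show "{{x, p x}, {y, p y}, {z, p z}} \<subseteq> M" "{{x, p x}, {y, p y}, {z, p z}} \<inter> S = {}"
        using W(2,5) that by simp_all
      show "\<Union>{{x, p x}, {y, p y}, {z, p z}} = \<Union>{{x, p y}, {y, p z}, {z, p x}}"
        by (simp add: insert_commute)
    qed (use adj neq that in \<open>auto simp: pairwise_insert disjnt_def\<close>)
    then show False
      using M_p[of x "p y"] neq by simp
  qed
  have "finite (\<Union>S)"
    using S_verts assms(1) by (auto simp: simple_graph_def intro: finite_subset)
  then have card_W: "card W = 2 * (n - k)"
    using card_Diff_subset[OF _ S_verts] card_Union_matching[OF assms(1) M S_M] card_S assms(2)
    by (simp add: W_def)
  note bound = card_edges[OF assms(2) card_W refl less_imp_le[OF assms(5)]]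
  have "graph_iso G (extremal_graph (n - k) (2 * k))"
    if "int (card (edges G)) = int n ^ 2 + 2 * int n * int k - int k ^ 2 - int k"
  proof -
    have "2 * card (nonadjacent_pairs G) = card W * (card W - 2)"
      using bound(2) that by blast
    then interpret tight_paired_graph G W p
      unfolding card_nonadjacent_pairs_eq_iff using no6 by unfold_locales blast+
    \<comment> \<open>The complete part has \<open>2 * k\<close> vertices because
      \<open>2 * n = 2 * (n - k) + 2 * k\<close>.\<close>
    show ?thesis
      using graph_iso_extremal_graph[OF card_W] assms by simp
  qed
  moreover have "int (card (edges G)) = int n ^ 2 + 2 * int n * int k - int k ^ 2 - int k"
    if "graph_iso G (extremal_graph (n - k) (2 * k))"
    using card_edges_graph_iso[OF assms(1) simple_extremal_graph that]
      card_edges_extremal_graph[OF assms(5)] by simp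
  ultimately show ?thesis
    using bound(1) by blast
qed

end
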